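(* Let $m>0$ and $n\ge1$ be integers and let $t_{-m}\le\ldots\le t_0\le t_1\le\ldots\le t_{n-1}\le t_n\le\ldots\le t_{n+m}$ be a non-decreasing sequence of real knots with $t_0<t_n$, such that no inner knot $t_1,\ldots,t_{n-1}$ has multiplicity greater than $m$. Fix $j$ with $0\le j<n$ and assume that the knot span $[t_j,t_{j+1})$ is non-empty. Then the $(m+1)^2$ adjusted Bernstein-Bézier coefficients $b_{m,k}^{(i,j)}$ of the B-spline functions $N_{m,i}$ over $[t_j,t_{j+1})$, for $i=j-m,j-m+1,\ldots,j$ and $k=0,1,\ldots,m$, can be computed with $O(m^2)$ arithmetic operations in the following way (i.e., each value computed below is the indicated coefficient): 1. Set $b_{0,0}^{(j,j)}=1$. Then, for $p=1,2,\ldots,m$, compute $b_{p,p}^{(j,j)}=\dfrac{t_{j+1}-t_j}{t_{j+p}-t_j}\,b_{p-1,p-1}^{(j,j)}$. Moreover set $b_{m,k}^{(j,j)}=0$ for $k=0,1,\ldots,m-1$. 2. For $p=1,2,\ldots,m$ and $i=j-1,j-2,\ldots,j-p$, compute $$b_{p,p}^{(i,j)}=\frac{t_{j+1}-t_i}{t_{p+i}-t_i}\,b_{p-1,p-1}^{(i,j)}+\frac{t_{p+i+1}-t_{j+1}}{t_{p+i+1}-t_{i+1}}\,b_{p-1,p-1}^{(i+1,j)},$$ where $b_{q,q}^{(i,j)}:=0$ for $i<j-q$, and any quotient $Q/(t_k-t_\ell)$ with $t_k=t_\ell$ is taken to be $0$. 3. Set $$b_{m,0}^{(j-m,j)}=\frac{(t_{j+1}-t_j)^{m-1}}{\prod_{k=2}^m(t_{j+1}-t_{j-k+1})},\qquad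 b_{m,k}^{(j-m,j)}=0\quad(k=1,2,\ldots,m).$$ 4. For $k=m-1,m-2,\ldots,0$ and $i=j-1,j-2,\ldots,j-m+1$, compute $$b_{m,k}^{(i,j)}=\frac{t_j-t_i}{t_{j+1}-t_i}\,b_{m,k+1}^{(i,j)}+\frac{v_{mi}}{t_{j+1}-t_i}\left((t_{j+1}-t_{m+i+2})\,b_{m,k}^{(i+1,j)}+(t_{m+i+2}-t_j)\,b_{m,k+1}^{(i+1,j)}\right),$$ where $v_{mi}:=(t_{m+i+1}-t_i)/(t_{m+i+2}-t_{i+1})$.
   Context: B-spline functions: for an integer $0\le p\le m$ and $-p\le i<n$, the B-spline basis function of degree $p$ on $[t_0,t_n]$ built on the given knots is $N_{p,i}(u):=(t_{i+p+1}-t_i)\,[t_i,t_{i+1},\ldots,t_{i+p+1}]\,(t-u)_+^p$ for $u$ not equal to any knot, extended to the knots by right-continuity (so $N_{0,i}$ is the indicator function of $[t_i,t_{i+1})$); here the generalized divided difference acts on the variable $t$, and $(x-c)^p_+=(x-c)^p$ if $x\ge c$ and $0$ if $x<c$. The generalized divided difference $[x_0,\ldots,x_r]f$ is the coefficient of $x^r$ in the polynomial of degree at most $r$ that interpolates $f$ at $x_0,\ldots,x_r$ in the Hermite sense (a node repeated $s$ times means matching $f,f',\ldots,f^{(s-1)}$ there). Convention: $N_{p,q}\equiv0$ if $q<-p$ or $q\ge n$. Adjusted Bernstein-Bézier coefficients: on a non-empty knot span $[t_j,t_{j+1})$, $0\le j<n$, the function $N_{p,i}$ is a polynomial of degree at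 most $p$, and the numbers $b^{(i,j)}_{p,k}$ are the unique reals with $N_{p,i}(u)=\sum_{k=0}^p b^{(i,j)}_{p,k}B^p_k\left(\frac{u-t_j}{t_{j+1}-t_j}\right)$ for $t_j\le u<t_{j+1}$, where $B^p_k(t):=\binom{p}{k}t^k(1-t)^{p-k}$. The multiplicity of a knot is the number of indices $\ell\in\{-m,\ldots,n+m\}$ for which $t_\ell$ equals it. Empty products equal $1$. Complexity is measured by the number of real arithmetic operations, and the constant in $O(m^2)$ is absolute (independent of $n$, $j$ and the knots). *)

theory Defs
  imports "HOL-Analysis.Analysis" "HOL-Computational_Algebra.Polynomial"
begin

text \<open>The knots are \<open>t l\<close> for \<open>l\<close> between \<open>- m\<close> and \<open>n + m\<close>; the values of \<open>t\<close>
  at other indices are irrelevant.\<close>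

definition knot_ix :: "nat \<Rightarrow> nat \<Rightarrow> int set" where
  "knot_ix m n = {- int m..int n + int m}"

definition multiplicity_of_knot :: "nat \<Rightarrow> nat \<Rightarrow> (int \<Rightarrow> real) \<Rightarrow> real \<Rightarrow> nat" where
  "multiplicity_of_knot m n t x = card {l \<in> knot_ix m n. t l = x}"

definition hermite_interpolates :: "real poly \<Rightarrow> (real \<Rightarrow> real) \<Rightarrow> real list \<Rightarrow> bool" where
  "hermite_interpolates q f xs \<longleftrightarrow>
     (\<forall>x\<in>set xs. \<forall>s<count_list xs x. poly ((pderiv ^^ s) q) x = (deriv ^^ s) f x)"

text \<open>For the nodes \<open>xs = [x\<^sub>0, \<dots>, x\<^sub>r]\<close> we have \<open>r = length xs - 1\<close>.\<close>

definition divided_difference :: "real list \<Rightarrow> (real \<Rightarrow> real) \<Rightarrow> real" where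
  "divided_difference xs f =
     coeff (THE q. degree q \<le> length xs - 1 \<and> hermite_interpolates q f xs) (length xs - 1)"

text \<open>\<open>(x - c)\<^sub>+\<^sup>p\<close>; for \<open>p = 0\<close> and \<open>x = c\<close> the value is \<open>1\<close>.\<close>

definition truncated_power :: "nat \<Rightarrow> real \<Rightarrow> real \<Rightarrow> real" where
  "truncated_power p x c = (if x \<ge> c then (x - c) ^ p else 0)"

definition bspline_off_knots :: "(int \<Rightarrow> real) \<Rightarrow> nat \<Rightarrow> int \<Rightarrow> real \<Rightarrow> real" where
  "bspline_off_knots t p i u =
     (t (i + int p + 1) - t i) *
       divided_difference (map t [i..i + int p + 1]) (\<lambda>x. truncated_power p x u)"

definition bspline :: "nat \<Rightarrow> nat \<Rightarrow> (int \<Rightarrow> real) \<Rightarrow> nat \<Rightarrow> int \<Rightarrow> real \<Rightarrow> real" where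
  "bspline m n t p i u =
     (if i < - int p \<or> i \<ge> int n then 0
      else if u \<in> t ` knot_ix m n then Lim (at_right u) (bspline_off_knots t p i)
      else bspline_off_knots t p i u)"

text \<open>\<open>adjusted_bb m n t p i j k\<close> is $b^{(i,j)}_{p,k}$. The condition on indices above \<open>p\<close> only
  makes the description determine a function on all of \<open>nat\<close>.\<close>

definition adjusted_bb :: "nat \<Rightarrow> nat \<Rightarrow> (int \<Rightarrow> real) \<Rightarrow> nat \<Rightarrow> int \<Rightarrow> int \<Rightarrow> nat \<Rightarrow> real" where
  "adjusted_bb m n t p i j =
     (THE b. (\<forall>u. t j \<le> u \<and> u < t (j + 1) \<longrightarrow>
                bspline m n t p i u =
                  (\<Sum>k\<le>p. b k * Bernstein p k ((u - t j) / (t (j + 1) - t j)))) \<and>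
             (\<forall>k>p. b k = 0))"

text \<open>A program is a sequence of assignments to cells indexed by triples; the cell \<open>(p, i, k)\<close> is
  meant to hold $b^{(i,j)}_{p,k}$ for the one fixed \<open>j\<close>. A right-hand side may read knots and
  cells. The cost is the number of arithmetic operations in the right-hand sides. A program is built
  without access to the knot values, so nothing depending on them comes for free.\<close>

type_synonym cell = "nat \<times> int \<times> nat"

datatype expr =
    Num real
  | Knot int
  | Coef nat int nat
  | Add expr expr (infixl \<open>\<oplus>\<close> 65)
  | Sub expr expr (infixl \<open>\<ominus>\<close> 65)
  | Mul expr expr (infixl \<open>\<otimes>\<close> 70)
  | Div expr expr (infixl \<open>\<oslash>\<close> 70)

type_synonym program = "(cell \<times> expr) list"

text \<open>Division by zero yields \<open>0\<close> in HOL, which is exactly the convention that a quotient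
  \<open>Q / (t k - t l)\<close> with \<open>t k = t l\<close> is taken to be \<open>0\<close>.\<close>

primrec eval_expr :: "(int \<Rightarrow> real) \<Rightarrow> (cell \<Rightarrow> real) \<Rightarrow> expr \<Rightarrow> real" where
  "eval_expr t s (Num c) = c"
| "eval_expr t s (Knot l) = t l"
| "eval_expr t s (Coef p i k) = s (p, i, k)"
| "eval_expr t s (a \<oplus> b) = eval_expr t s a + eval_expr t s b"
| "eval_expr t s (a \<ominus> b) = eval_expr t s a - eval_expr t s b"
| "eval_expr t s (a \<otimes> b) = eval_expr t s a * eval_expr t s b"
| "eval_expr t s (a \<oslash> b) = eval_expr t s a / eval_expr t s b"

primrec expr_ops :: "expr \<Rightarrow> nat" where
  "expr_ops (Num c) = 0"
| "expr_ops (Knot l) = 0"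
| "expr_ops (Coef p i k) = 0"
| "expr_ops (a \<oplus> b) = expr_ops a + expr_ops b + 1"
| "expr_ops (a \<ominus> b) = expr_ops a + expr_ops b + 1"
| "expr_ops (a \<otimes> b) = expr_ops a + expr_ops b + 1"
| "expr_ops (a \<oslash> b) = expr_ops a + expr_ops b + 1"

definition arith_ops :: "program \<Rightarrow> nat" where
  "arith_ops prog = (\<Sum>(c, e)\<leftarrow>prog. expr_ops e)"

primrec exec :: "(int \<Rightarrow> real) \<Rightarrow> program \<Rightarrow> (cell \<Rightarrow> real) \<Rightarrow> (cell \<Rightarrow> real)" where
  "exec t [] s = s"
| "exec t (a # prog) s = exec t prog (s(fst a := eval_expr t s (snd a)))"

text \<open>All assignments carried out during a run, with the assigned values, including those to cells
  that are overwritten later.\<close>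

primrec run_trace :: "(int \<Rightarrow> real) \<Rightarrow> program \<Rightarrow> (cell \<Rightarrow> real) \<Rightarrow> (cell \<times> real) list" where
  "run_trace t [] s = []"
| "run_trace t (a # prog) s =
     (fst a, eval_expr t s (snd a)) # run_trace t prog (s(fst a := eval_expr t s (snd a)))"

definition prod_expr :: "expr list \<Rightarrow> expr" where
  "prod_expr es = foldr (\<otimes>) es (Num 1)"

definition power_expr :: "expr \<Rightarrow> nat \<Rightarrow> expr" where
  "power_expr e r = prod_expr (replicate r e)"

definition step1 :: "nat \<Rightarrow> int \<Rightarrow> program" where
  "step1 m j =
     [((0, j, 0), Num 1)] @
     [((p, j, p),
       (Knot (j + 1) \<ominus> Knot j) \<oslash> (Knot (j + int p) \<ominus> Knot j) \<otimes> Coef (p - 1) j (p - 1)).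
       p \<leftarrow> [1..<m + 1]] @
     [((m, j, k), Num 0). k \<leftarrow> [0..<m]]"

text \<open>$b^{(i,j)}_{q,q}$ as read in the second step, with the convention that it is \<open>0\<close> for
  \<open>i < j - q\<close>.\<close>

definition diag_coef :: "int \<Rightarrow> nat \<Rightarrow> int \<Rightarrow> expr" where
  "diag_coef j q i = (if i < j - int q then Num 0 else Coef q i q)"

definition step2 :: "nat \<Rightarrow> int \<Rightarrow> program" where
  "step2 m j =
     [((p, i, p),
       (Knot (j + 1) \<ominus> Knot i) \<oslash> (Knot (int p + i) \<ominus> Knot i) \<otimes> diag_coef j (p - 1) i
       \<oplus> (Knot (int p + i + 1) \<ominus> Knot (j + 1)) \<oslash> (Knot (int p + i + 1) \<ominus> Knot (i + 1))
           \<otimes> diag_coef j (p - 1) (i + 1)).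
       p \<leftarrow> [1..<m + 1], i \<leftarrow> rev [j - int p..j - 1]]"

definition step3 :: "nat \<Rightarrow> int \<Rightarrow> program" where
  "step3 m j =
     [((m, j - int m, 0),
       power_expr (Knot (j + 1) \<ominus> Knot j) (m - 1)
       \<oslash> prod_expr [Knot (j + 1) \<ominus> Knot (j - int k + 1). k \<leftarrow> [2..<m + 1]])] @
     [((m, j - int m, k), Num 0). k \<leftarrow> [1..<m + 1]]"

definition v_expr :: "nat \<Rightarrow> int \<Rightarrow> expr" where
  "v_expr m i =
     (Knot (int m + i + 1) \<ominus> Knot i) \<oslash> (Knot (int m + i + 2) \<ominus> Knot (i + 1))"

definition step4 :: "nat \<Rightarrow> int \<Rightarrow> program" where
  "step4 m j =
     [((m, i, k),
       (Knot j \<ominus> Knot i) \<oslash> (Knot (j + 1) \<ominus> Knot i) \<otimes> Coef m i (k + 1)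
       \<oplus> v_expr m i \<oslash> (Knot (j + 1) \<ominus> Knot i)
           \<otimes> ((Knot (j + 1) \<ominus> Knot (int m + i + 2)) \<otimes> Coef m (i + 1) k
              \<oplus> (Knot (int m + i + 2) \<ominus> Knot j) \<otimes> Coef m (i + 1) (k + 1))).
       k \<leftarrow> rev [0..<m], i \<leftarrow> rev [j - int m + 1..j - 1]]"

definition bb_algorithm :: "nat \<Rightarrow> int \<Rightarrow> program" where
  "bb_algorithm m j = step1 m j @ step2 m j @ step3 m j @ step4 m j"

end

theory Submission
  imports Defs
begin

text \<open>Hermite interpolation is divisibility: on a fixed knot span the truncated power has a polynomial
  germ at every node, namely \<open>0\<close> to the left of \<open>u\<close> and \<open>(X - u)\<^sup>p\<close> to the right. The
  Aitken--Neville step then yields the Cox--de Boor recurrence for the divided differences. Carried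
  out on Bernstein--Bezier coefficients, that recurrence evaluates a blossom; since a blossom is
  symmetric, its arguments \<open>t\<^sub>j\<close> and \<open>t\<^sub>j\<^sub>+\<^sub>1\<close> may be spent in any order. All four steps of the algorithm
  follow from this freedom, the last one without differentiating the B-splines.\<close>

section \<open>Hermite interpolation\<close>

text \<open>The obstacle is coincident knots, at which denominators vanish. Dividing each B-spline
  by \<open>t (i + p + 1) - t i\<close> leaves one denominator per recurrence step. If the index
  window of the step contains \<open>j\<close> and \<open>j + 1\<close>, that denominator is
  positive because the span is non-empty; otherwise the resulting coefficient is zero, in agreement
  with division by zero in HOL. The coefficient with index \<open>k\<close> is the blossom at
  \<open>k\<close> copies of \<open>t (j + 1)\<close> and \<open>p - k\<close> copies of
  \<open>t j\<close>: steps 1 and 2 need the case without \<open>t j\<close>, step 3 the freedom to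
  choose which copy is spent first, and step 4 the affine dependence on a single argument.\<close>

lemma linear_power_dvd_Suc_iff:
  fixes D :: "real poly"
  shows "[:-x, 1:] ^ Suc c dvd D \<longleftrightarrow> poly D x = 0 \<and> [:-x, 1:] ^ c dvd pderiv D"
proof (cases "pderiv D = 0")
  case True
  then obtain a where "D = [:a:]"
    by (metis degree_eq_zeroE pderiv_eq_0_iff)
  then have "D = 0 \<longleftrightarrow> poly D x = 0" by simp
  then show ?thesis using True
    by (metis dvd_0_right dvd_power dvd_trans poly_eq_0_iff_dvd zero_less_Suc)
next
  case False
  then have "D \<noteq> 0" by auto
  show ?thesis
  proof (cases "poly D x = 0")
    case True
    \<comment> \<open>In characteristic 0, differentiation lowers the order of a root by exactly
      one.\<close>
    then have "order x D = Suc (order x (pderiv D))"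
      using False \<open>D \<noteq> 0\<close> by (intro order_pderiv) (auto simp: order_root)
    then show ?thesis using True False \<open>D \<noteq> 0\<close> by (simp add: order_divides del: power_Suc)
  next
    case False
    then show ?thesis
      by (metis dvd_power dvd_trans poly_eq_0_iff_dvd zero_less_Suc)
  qed
qed

lemma linear_power_dvd_iff_pderiv:
  fixes D :: "real poly"
  shows "[:-x, 1:] ^ c dvd D \<longleftrightarrow> (\<forall>s<c. poly ((pderiv ^^ s) D) x = 0)"
proof (induction c arbitrary: D)
  case (Suc c)
  show ?case
    unfolding linear_power_dvd_Suc_iff Suc.IH
    by (auto simp: less_Suc_eq_0_disj funpow_swap1 simp del: funpow.simps
             simp: funpow_Suc_right)
qed simp

lemma higher_deriv_poly:
  assumes "open S" "\<And>y. y \<in> S \<Longrightarrow> f y = poly g y" "y \<in> S"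
  shows "(deriv ^^ s) f y = poly ((pderiv ^^ s) (g :: real poly)) y"
  using assms(3)
proof (induction s arbitrary: y)
  case 0
  then show ?case using assms(2) by simp
next
  case (Suc s)
  have "((deriv ^^ s) f has_field_derivative poly (pderiv ((pderiv ^^ s) g)) y) (at y)"
    by (rule has_field_derivative_transform_within_open[OF poly_DERIV assms(1) Suc.prems])
       (simp add: Suc.IH)
  then show ?case by (simp add: DERIV_imp_deriv)
qed

lemma pderiv_funpow_diff: "(pderiv ^^ s) (p - q) = (pderiv ^^ s) p - (pderiv ^^ s) (q :: real poly)"
  by (induction s) (auto simp: pderiv_diff)

text \<open>The target is given by one polynomial \<open>g x\<close> per node \<open>x\<close>, which prescribes the germ there.\<close>

definition interpolates_germs :: "real poly \<Rightarrow> (real \<Rightarrow> real poly) \<Rightarrow> real list \<Rightarrow> bool" where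
  "interpolates_germs q g xs \<longleftrightarrow> (\<forall>x. [:-x, 1:] ^ count_list xs x dvd q - g x)"

text \<open>The passage from analysis to algebra. Points that are not nodes have exponent 0 and
  impose nothing.\<close>

lemma hermite_interpolates_iff:
  assumes "\<And>x. x \<in> set xs \<Longrightarrow> \<forall>\<^sub>F y in nhds x. f y = poly (g x) y"
  shows "hermite_interpolates q f xs \<longleftrightarrow> interpolates_germs q g xs"
proof -
  have "(\<forall>s<c. poly ((pderiv ^^ s) q) x = (deriv ^^ s) f x) \<longleftrightarrow> [:-x, 1:] ^ c dvd q - g x"
    if x: "x \<in> set xs" for x c
  proof -
    obtain S where S: "open S" "x \<in> S" "\<And>y. y \<in> S \<Longrightarrow> f y = poly (g x) y"
      using assms[OF x] unfolding eventually_nhds by blast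
    have "(deriv ^^ s) f x = poly ((pderiv ^^ s) (g x)) x" for s
      by (rule higher_deriv_poly[OF S(1) S(3) S(2)])
    then show ?thesis
      by (simp add: linear_power_dvd_iff_pderiv pderiv_funpow_diff)
  qed
  moreover have "[:-x, 1:] ^ count_list xs x dvd q - g x" if "x \<notin> set xs" for x
    using that by (simp add: count_list_0_iff)
  ultimately show ?thesis
    unfolding hermite_interpolates_def interpolates_germs_def by blast
qed

text \<open>The difference of two interpolants has \<open>length xs\<close> zeros counted with
  multiplicity, more than its degree admits.\<close>

lemma interpolates_germs_unique:
  assumes "interpolates_germs q g xs" "interpolates_germs q' g xs" "xs \<noteq> []"
    and "degree q \<le> length xs - 1" "degree q' \<le> length xs - 1"
  shows "q = q'"
proof (rule ccontr)
  assume "q \<noteq> q'"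
  define D where "D = q - q'"
  have D: "D \<noteq> 0" using \<open>q \<noteq> q'\<close> by (simp add: D_def)
  have dvd: "[:-x, 1:] ^ count_list xs x dvd D" for x
    using assms(1,2) dvd_diff[of _ "q - g x" "q' - g x"]
    unfolding interpolates_germs_def D_def by simp
  then have le: "count_list xs x \<le> order x D" for x
    using D order_divides by blast
  have root: "poly D x = 0" if "x \<in> set xs" for x
    using le[of x] that D by (metis count_list_0_iff le_zero_eq order_root)
  have fin: "finite {x. poly D x = 0}" using D by (rule poly_roots_finite)
  have "length xs = (\<Sum>x | poly D x = 0. count_list xs x)"
    using root fin by (intro sum_count_set[symmetric]) auto
  also have "\<dots> \<le> (\<Sum>x | poly D x = 0. order x D)"
    by (rule sum_mono) (rule le)
  also have "\<dots> \<le> degree D" using D by (rule sum_order_le_degree)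
  also have "\<dots> \<le> length xs - 1"
    using assms(4,5) by (simp add: D_def degree_diff_le)
  finally show False using assms(3) by (cases xs) auto
qed

text \<open>By uniqueness it suffices to exhibit one interpolant, so no general existence result is
  called for.\<close>

lemma divided_difference_eqI:
  assumes "\<And>x. x \<in> set xs \<Longrightarrow> \<forall>\<^sub>F y in nhds x. f y = poly (g x) y" "xs \<noteq> []"
    and "interpolates_germs q g xs" "degree q \<le> length xs - 1"
  shows "divided_difference xs f = coeff q (length xs - 1)"
proof -
  have iff: "hermite_interpolates r f xs \<longleftrightarrow> interpolates_germs r g xs" for r
    using assms(1) by (rule hermite_interpolates_iff)
  have "(THE r. degree r \<le> length xs - 1 \<and> hermite_interpolates r f xs) = q"
    unfolding iff using assms interpolates_germs_unique by blast
  then show ?thesis by (simp add: divided_difference_def)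
qed

text \<open>The Aitken--Neville step, combined with a multiplication of the target by \<open>X - u\<close>: with
  \<open>\<kappa> = (b - u) / (b - a)\<close> one has \<open>(1 - \<kappa>) (X - b) + \<kappa> (X - a) = X - u\<close>. On leading
  coefficients this is the Cox--de Boor recurrence.\<close>

lemma interpolates_germs_neville:
  assumes "a \<noteq> b" "interpolates_germs q g (a # ys)" "interpolates_germs q' g (ys @ [b])"
  shows "interpolates_germs
    (smult ((u - a) / (b - a)) ([:-b, 1:] * q) + smult ((b - u) / (b - a)) ([:-a, 1:] * q'))
    (\<lambda>x. [:-u, 1:] * g x) (a # ys @ [b])"
  unfolding interpolates_germs_def
proof
  fix x
  define \<kappa> where "\<kappa> = (b - u) / (b - a)"
  have \<kappa>: "(u - a) / (b - a) = 1 - \<kappa>"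
    using assms(1) by (simp add: \<kappa>_def diff_divide_eq_iff)
  have "\<kappa> * (b - a) = b - u" using assms(1) by (simp add: \<kappa>_def)
  then have "(1 - \<kappa>) * b + \<kappa> * a = u"
    by (simp add: left_diff_distrib right_diff_distrib)
  then have comb: "[:-u, 1:] = smult (1 - \<kappa>) [:-b, 1:] + smult \<kappa> [:-a, 1:]"
    by auto
  have eq: "smult (1 - \<kappa>) ([:-b, 1:] * q) + smult \<kappa> ([:-a, 1:] * q') - [:-u, 1:] * g x
     = smult (1 - \<kappa>) ([:-b, 1:] * (q - g x)) + smult \<kappa> ([:-a, 1:] * (q' - g x))"
    unfolding comb by (simp only: smult_diff_right right_diff_distrib distrib_right mult_smult_left
        add_diff_add)
  have q: "[:-x, 1:] ^ count_list (a # ys) x dvd q - g x"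
    and q': "[:-x, 1:] ^ count_list (ys @ [b]) x dvd q' - g x"
    using assms(2,3) unfolding interpolates_germs_def by blast+
  \<comment> \<open>The error of \<open>q\<close> lacks just one zero, at \<open>b\<close>, and the
    factor \<open>X - b\<close> supplies it; the error of \<open>q'\<close> is treated alike at
    \<open>a\<close>.\<close>
  have "[:-x, 1:] ^ count_list (a # ys @ [b]) x dvd [:-b, 1:] * (q - g x)"
  proof (cases "x = b")
    case True
    then have "count_list (a # ys @ [b]) x = Suc (count_list (a # ys) x)" using assms(1) by simp
    with True q show ?thesis by (simp only: power_Suc mult_dvd_mono dvd_refl)
  next
    case False
    then have "count_list (a # ys @ [b]) x = count_list (a # ys) x" by simp
    with q show ?thesis by (simp only: dvd_mult)
  qed
  moreover have "[:-x, 1:] ^ count_list (a # ys @ [b]) x dvd [:-a, 1:] * (q' - g x)"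
  proof (cases "x = a")
    case True
    then have "count_list (a # ys @ [b]) x = Suc (count_list (ys @ [b]) x)" using assms(1) by simp
    with True q' show ?thesis by (simp only: power_Suc mult_dvd_mono dvd_refl)
  next
    case False
    then have "count_list (a # ys @ [b]) x = count_list (ys @ [b]) x" by simp
    with q' show ?thesis by (simp only: dvd_mult)
  qed
  ultimately show "[:-x, 1:] ^ count_list (a # ys @ [b]) x dvd
      smult ((u - a) / (b - a)) ([:-b, 1:] * q) + smult ((b - u) / (b - a)) ([:-a, 1:] * q')
        - [:-u, 1:] * g x"
    unfolding \<kappa> \<kappa>_def[symmetric] eq by (intro dvd_add dvd_smult)
qed

text \<open>A relation rather than a function: the value carries its interpolant along, which is
  both what the Neville step consumes and what \<open>divided_difference_eqI\<close> asks
  for.\<close>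

definition has_germ_difference :: "(real \<Rightarrow> real poly) \<Rightarrow> real list \<Rightarrow> real \<Rightarrow> bool" where
  "has_germ_difference g xs d \<longleftrightarrow>
     (\<exists>q. degree q \<le> length xs - 1 \<and> interpolates_germs q g xs \<and> coeff q (length xs - 1) = d)"

lemma coeff_linear_mult_Suc:
  assumes "degree q \<le> r"
  shows "coeff ([:c, 1:] * q) (Suc r) = coeff (q :: real poly) r"
  using assms by (simp add: coeff_eq_0)

lemma has_germ_difference_neville:
  assumes "a \<noteq> b" "has_germ_difference g (a # ys) A" "has_germ_difference g (ys @ [b]) B"
  shows "has_germ_difference (\<lambda>x. [:-u, 1:] * g x) (a # ys @ [b])
           (((u - a) * A + (b - u) * B) / (b - a))"
proof -
  obtain q q' where q: "degree q \<le> length ys" "interpolates_germs q g (a # ys)" "coeff q (length ys) = A"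
    and q': "degree q' \<le> length ys" "interpolates_germs q' g (ys @ [b])" "coeff q' (length ys) = B"
    using assms(2,3) unfolding has_germ_difference_def by auto
  let ?H = "smult ((u - a) / (b - a)) ([:-b, 1:] * q) + smult ((b - u) / (b - a)) ([:-a, 1:] * q')"
  have "degree ([:c, 1:] * r) \<le> Suc (length ys)" if "degree r \<le> length ys" for c and r :: "real poly"
    using degree_mult_le[of "[:c, 1:]" r] that by simp
  then have "degree ?H \<le> Suc (length ys)"
    using q(1) q'(1) by (meson degree_add_le degree_smult_le order_trans)
  moreover have "coeff ?H (Suc (length ys)) = ((u - a) * A + (b - u) * B) / (b - a)"
    using q q' by (simp only: coeff_add coeff_smult coeff_linear_mult_Suc) (simp add: add_divide_distrib)
  ultimately show ?thesis
    using interpolates_germs_neville[OF assms(1) q(2) q'(2), of u]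
    unfolding has_germ_difference_def by fastforce
qed

section \<open>Bernstein polynomials\<close>

lemma Bernstein_Suc_0: "Bernstein (Suc p) 0 x = (1 - x) * Bernstein p 0 x"
  by (simp add: Bernstein_def)

lemma Bernstein_Suc_Suc:
  assumes "k \<le> p"
  shows "Bernstein (Suc p) (Suc k) x = (1 - x) * Bernstein p (Suc k) x + x * Bernstein p k x"
proof (cases "k = p")
  case False
  then have "p - k = Suc (p - Suc k)" using assms by simp
  then show ?thesis by (simp add: Bernstein_def distrib_right distrib_left mult_ac)
qed (simp add: Bernstein_def)

text \<open>One step of de Casteljau's algorithm. It expresses the degree \<open>Suc p\<close> sum
  in the degree \<open>p\<close> basis, with coefficients depending on \<open>x\<close>, so that
  both sides of the B-spline recurrence can be compared termwise.\<close>

lemma Bernstein_sum_Suc: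
  "(\<Sum>k\<le>Suc p. b k * Bernstein (Suc p) k x)
     = (\<Sum>k\<le>p. ((1 - x) * b k + x * b (Suc k)) * Bernstein p k x)"
proof -
  have "(\<Sum>k\<le>Suc p. b k * Bernstein (Suc p) k x)
    = b 0 * Bernstein (Suc p) 0 x + (\<Sum>k\<le>p. b (Suc k) * Bernstein (Suc p) (Suc k) x)"
    by (rule sum.atMost_Suc_shift)
  also have "\<dots> = (1 - x) * (b 0 * Bernstein p 0 x + (\<Sum>k\<le>p. b (Suc k) * Bernstein p (Suc k) x))
      + x * (\<Sum>k\<le>p. b (Suc k) * Bernstein p k x)"
    by (simp add: Bernstein_Suc_0 Bernstein_Suc_Suc sum.distrib sum_distrib_left distrib_left mult_ac)
  also have "b 0 * Bernstein p 0 x + (\<Sum>k\<le>p. b (Suc k) * Bernstein p (Suc k) x)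
      = (\<Sum>k\<le>Suc p. b k * Bernstein p k x)"
    by (rule sum.atMost_Suc_shift[symmetric])
  also have "\<dots> = (\<Sum>k\<le>p. b k * Bernstein p k x)"
    by (simp add: Bernstein_def)
  finally show ?thesis
    by (simp add: sum.distrib sum_distrib_left distrib_right mult.assoc)
qed

text \<open>Dividing by \<open>(1 - x)\<^sup>p\<close> turns the sum into a polynomial in \<open>x / (1 - x)\<close>.\<close>

lemma Bernstein_sum_eq_0:
  assumes "\<And>x. 0 \<le> x \<Longrightarrow> x < 1 \<Longrightarrow> (\<Sum>k\<le>p. b k * Bernstein p k x) = 0" "k \<le> p"
  shows "b k = 0"
proof -
  have zero: "(\<Sum>k\<le>p. (b k * (p choose k)) * y ^ k) = 0" if "y \<ge> 0" for y :: real
  proof -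
    \<comment> \<open>The inverse of \<open>y = x / (1 - x)\<close>; it maps the half-line
      \<open>y >= 0\<close> onto \<open>[0, 1)\<close>, giving infinitely many roots.\<close>
    define x where "x = y / (1 + y)"
    have x: "0 \<le> x" "x < 1" "1 - x = 1 / (1 + y)" using that by (auto simp: x_def field_simps)
    have "Bernstein p k x * (1 + y) ^ p = (p choose k) * y ^ k" if "k \<le> p" for k
    proof -
      have "(1 + y) ^ p = (1 + y) ^ k * (1 + y) ^ (p - k)"
        using that by (simp flip: power_add)
      then show ?thesis using \<open>y \<ge> 0\<close>
        by (simp add: Bernstein_def x(3)) (simp add: x_def power_divide)
    qed
    then have "(\<Sum>k\<le>p. (b k * (p choose k)) * y ^ k) = (\<Sum>k\<le>p. b k * Bernstein p k x) * (1 + y) ^ p"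
      unfolding sum_distrib_right by (intro sum.cong) (simp_all add: mult.assoc)
    then show ?thesis using assms(1)[OF x(1,2)] by simp
  qed
  have "infinite {y :: real. (\<Sum>k\<le>p. (b k * (p choose k)) * y ^ k) = 0}"
    using zero by (intro infinite_super[OF _ infinite_Ici[of 0]]) auto
  then have "b k * (p choose k) = 0"
    using polyfun_finite_roots[of "\<lambda>k. b k * (p choose k)" p] assms(2) by blast
  then show ?thesis using assms(2) by simp
qed

section \<open>Programs\<close>

text \<open>\<open>V\<close> is the intended content of every cell, \<open>K\<close> the set of
  cells known to hold it. Quantifying over all stores that agree with \<open>V\<close> on
  \<open>K\<close> leaves no store to track, makes the initial one irrelevant, and allows a cell to
  be written twice, as happens to \<open>(m, j - int m, m)\<close> in steps 2 and 3.\<close>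

primrec computes :: "(int \<Rightarrow> real) \<Rightarrow> (cell \<Rightarrow> real) \<Rightarrow> cell set \<Rightarrow> program \<Rightarrow> bool" where
  "computes t V K [] \<longleftrightarrow> True"
| "computes t V K (a # prog) \<longleftrightarrow>
     (\<forall>s. (\<forall>c\<in>K. s c = V c) \<longrightarrow> eval_expr t s (snd a) = V (fst a))
     \<and> computes t V (insert (fst a) K) prog"

lemma computes_mono: "computes t V K prog \<Longrightarrow> K \<subseteq> K' \<Longrightarrow> computes t V K' prog"
proof (induction prog arbitrary: K K')
  case (Cons a prog)
  have "computes t V (insert (fst a) K') prog"
    using Cons.IH[of "insert (fst a) K" "insert (fst a) K'"] Cons.prems by auto
  moreover have "\<forall>s. (\<forall>c\<in>K'. s c = V c) \<longrightarrow> eval_expr t s (snd a) = V (fst a)"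
    using Cons.prems by (meson computes.simps(2) subsetD)
  ultimately show ?case by simp
qed simp

lemma computes_append:
  "computes t V K (prog @ prog') \<longleftrightarrow>
     computes t V K prog \<and> computes t V (K \<union> fst ` set prog) prog'"
  by (induction prog arbitrary: K) auto

text \<open>\<open>R\<close> is the loop order, \<open><\<close> for upward and \<open>>\<close> for
  downward loops: a body may rely on the cells written for all \<open>R\<close>-smaller loop
  values.\<close>

lemma computes_concat_map:
  assumes "asymp R" "sorted_wrt R xs"
    and "\<And>x. x \<in> set xs \<Longrightarrow> computes t V (K \<union> (\<Union>y\<in>{y \<in> set xs. R y x}. fst ` set (g y))) (g x)"
  shows "computes t V K (concat (map g xs))"
  using assms(2,3)
proof (induction xs rule: rev_induct)
  case (snoc x xs)
  have "computes t V (K \<union> (\<Union>y\<in>{y \<in> set xs. R y z}. fst ` set (g y))) (g z)" if "z \<in> set xs" for z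
  proof -
    have "\<not> R x z"
      using snoc.prems(1) that assms(1) by (auto simp: sorted_wrt_append dest: asympD)
    then have "{y \<in> set (xs @ [x]). R y z} = {y \<in> set xs. R y z}" by auto
    then show ?thesis using snoc.prems(2)[of z] that by simp
  qed
  then have "computes t V K (concat (map g xs))"
    using snoc.IH snoc.prems(1) by (simp add: sorted_wrt_append)
  moreover have "computes t V (K \<union> fst ` set (concat (map g xs))) (g x)"
    using snoc.prems(2)[of x] by (rule computes_mono) (auto dest: asympD[OF assms(1)])
  ultimately show ?case by (simp add: computes_append)
qed simp

lemma computes_map:
  assumes "asymp R" "sorted_wrt R xs"
    and "\<And>x s. x \<in> set xs \<Longrightarrow> \<forall>c\<in>K. s c = V c \<Longrightarrow> \<forall>y\<in>set xs. R y x \<longrightarrow> s (fst (f y)) = V (fst (f y))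
           \<Longrightarrow> eval_expr t s (snd (f x)) = V (fst (f x))"
  shows "computes t V K (map f xs)"
proof -
  have "computes t V K (concat (map (\<lambda>x. [f x]) xs))"
    by (rule computes_concat_map[OF assms(1,2)]) (auto intro!: assms(3))
  then show ?thesis by simp
qed

lemma computes_run_trace:
  assumes "computes t V K prog" "\<forall>c\<in>K. s c = V c" "(c, v) \<in> set (run_trace t prog s)"
  shows "v = V c"
  using assms
proof (induction prog arbitrary: K s)
  case (Cons a prog)
  then have eval: "eval_expr t s (snd a) = V (fst a)" by simp
  then have agree: "\<forall>c\<in>insert (fst a) K. (s(fst a := eval_expr t s (snd a))) c = V c"
    using Cons.prems by simp
  have rest: "computes t V (insert (fst a) K) prog" using Cons.prems(1) by simp
  show ?case
    using Cons.prems(3) Cons.IH[OF rest agree] eval by (simp del: fun_upd_apply) blast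
qed simp

lemma computes_exec:
  assumes "computes t V K prog" "\<forall>c\<in>K. s c = V c" "c \<in> K \<union> fst ` set prog"
  shows "exec t prog s c = V c"
  using assms
proof (induction prog arbitrary: K s)
  case (Cons a prog)
  then have eval: "eval_expr t s (snd a) = V (fst a)" by simp
  then have agree: "\<forall>c\<in>insert (fst a) K. (s(fst a := eval_expr t s (snd a))) c = V c"
    using Cons.prems by simp
  have rest: "computes t V (insert (fst a) K) prog" using Cons.prems(1) by simp
  show ?case
    using Cons.prems(3) Cons.IH[OF rest agree] by (simp del: fun_upd_apply)
qed simp

lemma eval_prod_expr: "eval_expr t s (prod_expr es) = (\<Prod>e\<leftarrow>es. eval_expr t s e)"
  by (induction es) (auto simp: prod_expr_def)

lemma eval_power_expr: "eval_expr t s (power_expr e r) = eval_expr t s e ^ r"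
  by (simp add: power_expr_def eval_prod_expr prod_list_replicate)

lemma expr_ops_prod_expr: "expr_ops (prod_expr es) = (\<Sum>e\<leftarrow>es. expr_ops e + 1)"
  by (induction es) (auto simp: prod_expr_def)

section \<open>Operation count\<close>

lemma arith_ops_append: "arith_ops (prog @ prog') = arith_ops prog + arith_ops prog'"
  by (simp add: arith_ops_def)

lemma arith_ops_concat_map_le:
  assumes "\<And>x. x \<in> set xs \<Longrightarrow> arith_ops (g x) \<le> B"
  shows "arith_ops (concat (map g xs)) \<le> length xs * B"
  using assms
proof (induction xs)
  case (Cons x xs)
  then have "arith_ops (g x) \<le> B" "arith_ops (concat (map g xs)) \<le> length xs * B" by auto
  then show ?case by (simp add: arith_ops_append)
qed (simp add: arith_ops_def)

lemma arith_ops_map_le: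
  assumes "\<And>x. x \<in> set xs \<Longrightarrow> expr_ops (e x) \<le> B"
  shows "arith_ops (map (\<lambda>x. (c x, e x)) xs) \<le> length xs * B"
  using assms by (induction xs) (auto simp: arith_ops_def intro: add_mono)

text \<open>The constant is 4 + 9 + 6 + 16, one summand per step: 9 and 16 operations in the bodies
  of the two double loops, and linear bounds for steps 1 and 3 absorbed by
  \<open>m \<le> m * m\<close>.\<close>

lemma arith_ops_bb_algorithm:
  assumes "m > 0"
  shows "arith_ops (bb_algorithm m j) \<le> 35 * m\<^sup>2"
proof -
  have "arith_ops (step1 m j) \<le> 4 * m"
  proof -
    have "arith_ops (map (\<lambda>p. ((p, j, p),
        (Knot (j + 1) \<ominus> Knot j) \<oslash> (Knot (j + int p) \<ominus> Knot j) \<otimes> Coef (p - 1) j (p - 1))) [1..<m + 1])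
      \<le> length [1..<m + 1] * 4" by (rule arith_ops_map_le) simp
    moreover have "arith_ops (map (\<lambda>k. ((m, j, k), Num 0)) [0..<m]) \<le> length [0..<m] * 0"
      by (rule arith_ops_map_le) simp
    moreover have "arith_ops [((0, j, 0), Num 1)] = 0" by (simp add: arith_ops_def)
    ultimately show ?thesis
      unfolding step1_def arith_ops_append by (simp del: upt_Suc append.simps)
  qed
  moreover have "arith_ops (step2 m j) \<le> length [1..<m + 1] * (m * 9)"
    unfolding step2_def
  proof (rule arith_ops_concat_map_le)
    fix p assume "p \<in> set [1..<m + 1]"
    then have "p \<le> m" by auto
    have "arith_ops (map (\<lambda>i. ((p, i, p),
        (Knot (j + 1) \<ominus> Knot i) \<oslash> (Knot (int p + i) \<ominus> Knot i) \<otimes> diag_coef j (p - 1) i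
        \<oplus> (Knot (int p + i + 1) \<ominus> Knot (j + 1)) \<oslash> (Knot (int p + i + 1) \<ominus> Knot (i + 1))
            \<otimes> diag_coef j (p - 1) (i + 1))) (rev [j - int p..j - 1]))
      \<le> length (rev [j - int p..j - 1]) * 9" (is "?a \<le> _")
      by (rule arith_ops_map_le) (simp add: diag_coef_def)
    also have "\<dots> \<le> m * 9" using \<open>p \<le> m\<close> by simp
    finally show "?a \<le> m * 9" .
  qed
  moreover have "arith_ops (step3 m j) \<le> 6 * m"
  proof -
    have "arith_ops (map (\<lambda>k. ((m, j - int m, k), Num 0)) [1..<m + 1]) \<le> length [1..<m + 1] * 0"
      by (rule arith_ops_map_le) simp
    moreover have "expr_ops (power_expr (Knot (j + 1) \<ominus> Knot j) (m - 1)
       \<oslash> prod_expr [Knot (j + 1) \<ominus> Knot (j - int k + 1). k \<leftarrow> [2..<m + 1]]) \<le> 6 * m"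
      using assms by (simp add: power_expr_def expr_ops_prod_expr sum_list_replicate o_def
          sum_list_triv del: upt_Suc)
    moreover have "arith_ops [(c, e)] = expr_ops e" for c e by (simp add: arith_ops_def)
    ultimately show ?thesis
      unfolding step3_def arith_ops_append by (simp del: upt_Suc append.simps)
  qed
  moreover have "arith_ops (step4 m j) \<le> length (rev [0..<m]) * (m * 16)"
    unfolding step4_def
  proof (rule arith_ops_concat_map_le)
    fix k
    have "arith_ops (map (\<lambda>i. ((m, i, k),
        (Knot j \<ominus> Knot i) \<oslash> (Knot (j + 1) \<ominus> Knot i) \<otimes> Coef m i (k + 1)
        \<oplus> v_expr m i \<oslash> (Knot (j + 1) \<ominus> Knot i)
           \<otimes> ((Knot (j + 1) \<ominus> Knot (int m + i + 2)) \<otimes> Coef m (i + 1) k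
              \<oplus> (Knot (int m + i + 2) \<ominus> Knot j) \<otimes> Coef m (i + 1) (k + 1))))
        (rev [j - int m + 1..j - 1]))
      \<le> length (rev [j - int m + 1..j - 1]) * 16" (is "?a \<le> _")
      by (rule arith_ops_map_le) (simp add: v_expr_def)
    also have "\<dots> \<le> m * 16" by simp
    finally show "?a \<le> m * 16" .
  qed
  moreover have "length [1..<m + 1] * (m * 9) = 9 * (m * m)"
    "length (rev [0..<m]) * (m * 16) = 16 * (m * m)" "m \<le> m * m"
    using assms by simp_all
  ultimately show ?thesis
    unfolding bb_algorithm_def arith_ops_append power2_eq_square by linarith
qed

section \<open>The coefficients on a knot span\<close>

text \<open>Two recurrence steps with arguments \<open>y\<close> and \<open>z\<close>, in either
  order. The terms in \<open>A\<close> and \<open>C\<close> are visibly symmetric. In the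
  coefficient of \<open>B\<close>, swapping changes the two fractions by \<open>y - z\<close> and
  \<open>z - y\<close>, which cancel once the denominators are nonzero.\<close>

lemma de_boor_commute:
  fixes a b c d y z A B C :: real
  assumes "B \<noteq> 0 \<Longrightarrow> c \<noteq> a \<and> d \<noteq> b"
  shows "(y - a) * (((z - a) * A + (c - z) * B) / (c - a))
           + (d - y) * (((z - b) * B + (d - z) * C) / (d - b))
       = (z - a) * (((y - a) * A + (c - y) * B) / (c - a))
           + (d - z) * (((y - b) * B + (d - y) * C) / (d - b))"
proof (cases "B = 0")
  case True
  then show ?thesis by (simp add: mult_ac)
next
  case False
  with assms have "c - a \<noteq> 0" "d - b \<noteq> 0" by auto
  then show ?thesis by (simp add: divide_simps) (simp add: algebra_simps)
qed

locale knot_span =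
  fixes m n :: nat and t :: "int \<Rightarrow> real" and j :: int
  assumes mono: "mono_on {- int m..int n + int m} t"
    and j: "0 \<le> j" "j < int n"
    and span: "t j < t (j + 1)"
begin

text \<open>Bernstein--Bezier coefficients of the polynomial that equals \<open>N\<^sub>p\<^sub>,\<^sub>i / (t\<^sub>i\<^sub>+\<^sub>p\<^sub>+\<^sub>1 - t\<^sub>i)\<close> on the
  span. They are values of its blossom at \<open>t\<^sub>j\<close> and \<open>t\<^sub>j\<^sub>+\<^sub>1\<close>, so the recurrence has
  one free blossom argument; this definition spends \<open>t\<^sub>j\<close> whenever possible.\<close>

fun ncoef :: "nat \<Rightarrow> int \<Rightarrow> nat \<Rightarrow> real" where
  "ncoef 0 i k = (if i = j then 1 / (t (j + 1) - t j) else 0)"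
| "ncoef (Suc p) i k = (
     if k \<le> p then ((t j - t i) * ncoef p i k + (t (i + int p + 2) - t j) * ncoef p (i + 1) k)
                     / (t (i + int p + 2) - t i)
     else ((t (j + 1) - t i) * ncoef p i p + (t (i + int p + 2) - t (j + 1)) * ncoef p (i + 1) p)
            / (t (i + int p + 2) - t i))"

text \<open>The source of all nonzero denominators: the window from \<open>i\<close> to
  \<open>i'\<close> contains the whole span.\<close>

lemma less_knots:
  assumes "- int m \<le> i" "i \<le> j" "j < i'" "i' \<le> int n + int m"
  shows "t i < t i'"
proof -
  have "t i \<le> t j" "t (j + 1) \<le> t i'"
    using assms j by (auto intro!: mono_onD[OF mono])
  then show ?thesis using span by simp
qed

lemma ncoef_outside: "i < j - int p \<or> j < i \<Longrightarrow> ncoef p i k = 0"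
  by (induction p arbitrary: i k) auto

text \<open>Symmetry of the blossom: the free argument may as well be \<open>t\<^sub>j\<^sub>+\<^sub>1\<close>.\<close>

lemma ncoef_Suc_Suc:
  assumes "k \<le> p" "- int m \<le> i" "i + int p + 2 \<le> int n + int m"
  shows "ncoef (Suc p) i (Suc k) =
    ((t (j + 1) - t i) * ncoef p i k + (t (i + int p + 2) - t (j + 1)) * ncoef p (i + 1) k)
      / (t (i + int p + 2) - t i)"
  using assms
proof (induction p arbitrary: i k)
  case (Suc q)
  show ?case
  proof (cases "k = Suc q")
    case False
    then have k: "k \<le> q" using Suc.prems by simp
    let ?a = "t i" and ?b = "t (i + 1)" and ?c = "t (i + int q + 2)" and ?d = "t (i + int q + 3)"
    have ix: "i + 1 + int q + 2 = i + int q + 3" "i + 1 + 1 = i + 2" "i + (1 + int q) + 2 = i + int q + 3"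
      by auto
    have up: "ncoef (Suc q) i (Suc k) = ((t (j + 1) - ?a) * ncoef q i k + (?c - t (j + 1)) * ncoef q (i + 1) k) / (?c - ?a)"
      "ncoef (Suc q) (i + 1) (Suc k) = ((t (j + 1) - ?b) * ncoef q (i + 1) k + (?d - t (j + 1)) * ncoef q (i + 2) k) / (?d - ?b)"
      using Suc.IH[of k i] Suc.IH[of k "i + 1"] k Suc.prems by (simp_all add: ix)
    have low: "ncoef (Suc q) i k = ((t j - ?a) * ncoef q i k + (?c - t j) * ncoef q (i + 1) k) / (?c - ?a)"
      "ncoef (Suc q) (i + 1) k = ((t j - ?b) * ncoef q (i + 1) k + (?d - t j) * ncoef q (i + 2) k) / (?d - ?b)"
      using k by (simp_all add: ix)
    \<comment> \<open>A nonzero middle coefficient forces the span into the index window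
      \<open>i + 1, ..., i + q + 2\<close>, which both differences enclose.\<close>
    have "?c \<noteq> ?a \<and> ?d \<noteq> ?b" if "ncoef q (i + 1) k \<noteq> 0"
    proof -
      have "\<not> (i + 1 < j - int q \<or> j < i + 1)"
        using that ncoef_outside[of "i + 1" q k] by argo
      then have "?a < ?c" "?b < ?d" using Suc.prems by (intro less_knots; simp)+
      then show ?thesis by simp
    qed
    then have "(t j - ?a) * ncoef (Suc q) i (Suc k) + (?d - t j) * ncoef (Suc q) (i + 1) (Suc k)
      = (t (j + 1) - ?a) * ncoef (Suc q) i k + (?d - t (j + 1)) * ncoef (Suc q) (i + 1) k"
      unfolding up low by (rule de_boor_commute)
    moreover have "ncoef (Suc (Suc q)) i (Suc k)
       = ((t j - ?a) * ncoef (Suc q) i (Suc k) + (?d - t j) * ncoef (Suc q) (i + 1) (Suc k)) / (?d - ?a)"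
      using k by (subst ncoef.simps(2)) (simp add: ix del: ncoef.simps(2))
    ultimately show ?thesis by (simp add: ix del: ncoef.simps(2))
  qed (simp add: add_ac)
qed simp

text \<open>A polynomial on the whole line that continues the piece on the span, so its limit at
  \<open>t j\<close> comes from continuity.\<close>

definition normalized :: "nat \<Rightarrow> int \<Rightarrow> real \<Rightarrow> real" where
  "normalized p i u = (\<Sum>k\<le>p. ncoef p i k * Bernstein p k ((u - t j) / (t (j + 1) - t j)))"

lemma normalized_outside: "i < j - int p \<or> j < i \<Longrightarrow> normalized p i u = 0"
  by (simp add: normalized_def ncoef_outside)

text \<open>The two recurrences for \<open>ncoef\<close> differ only in the free argument,
  \<open>t j\<close> or \<open>t (j + 1)\<close>, and are affine in it. Blending them with weights
  \<open>1 - x\<close> and \<open>x\<close> puts \<open>u\<close> in its place.\<close>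

lemma normalized_Suc:
  assumes "- int m \<le> i" "i + int p + 2 \<le> int n + int m"
  shows "normalized (Suc p) i u =
    ((u - t i) * normalized p i u + (t (i + int p + 2) - u) * normalized p (i + 1) u)
      / (t (i + int p + 2) - t i)"
proof -
  define x where "x = (u - t j) / (t (j + 1) - t j)"
  define d where "d = t (i + int p + 2)"
  have u: "u = t j + x * (t (j + 1) - t j)" using span by (simp add: x_def)
  have "(1 - x) * ncoef (Suc p) i k + x * ncoef (Suc p) i (Suc k)
      = ((u - t i) * ncoef p i k + (d - u) * ncoef p (i + 1) k) / (d - t i)" if "k \<le> p" for k
  proof -
    have low: "ncoef (Suc p) i k = ((t j - t i) * ncoef p i k + (d - t j) * ncoef p (i + 1) k) / (d - t i)"
      using that by (simp add: d_def)
    have up: "ncoef (Suc p) i (Suc k)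
       = ((t (j + 1) - t i) * ncoef p i k + (d - t (j + 1)) * ncoef p (i + 1) k) / (d - t i)"
      using ncoef_Suc_Suc[OF that assms] by (simp add: d_def)
    show ?thesis unfolding low up
      by (simp add: add_divide_distrib[symmetric] times_divide_eq_right del: times_divide_eq_left)
         (simp add: u algebra_simps)
  qed
  then show ?thesis
    unfolding normalized_def x_def[symmetric] d_def[symmetric] Bernstein_sum_Suc
    by (simp add: sum_divide_distrib sum_distrib_left sum.distrib[symmetric] algebra_simps
          add_divide_distrib[symmetric])
qed

section \<open>B-splines on the span from divided differences\<close>

definition germs :: "real \<Rightarrow> nat \<Rightarrow> real \<Rightarrow> real poly" where
  "germs u p x = (if x < u then 0 else [:-u, 1:] ^ p)"

text \<open>The reason for multiplying by \<open>X - u\<close> in the Neville step: it raises the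
  truncated power by one degree on both sides of \<open>u\<close>.\<close>

lemma germs_Suc: "germs u (Suc p) = (\<lambda>x. [:-u, 1:] * germs u p x)"
  by (auto simp: germs_def fun_eq_iff)

lemma knot_le: "- int m \<le> i \<Longrightarrow> i \<le> j \<Longrightarrow> t i \<le> t j"
  and knot_ge: "j < i \<Longrightarrow> i \<le> int n + int m \<Longrightarrow> t (j + 1) \<le> t i"
  using j by (auto intro!: mono_onD[OF mono])

text \<open>With all nodes on one side of \<open>u\<close> the target is a single polynomial of
  degree at most \<open>p\<close>, hence its own interpolant, without a term of degree
  \<open>p + 1\<close>. This covers the windows whose end knots may coincide, where the Neville step
  fails.\<close>

lemma has_germ_difference_outside:
  assumes "t j < u" "u < t (j + 1)" "- int m \<le> i" "i + int p + 1 \<le> int n + int m"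
    and "i < j - int p \<or> j < i"
  shows "has_germ_difference (germs u p) (map t [i..i + int p + 1]) 0"
proof -
  let ?xs = "map t [i..i + int p + 1]"
  have germsI: "interpolates_germs q g ?xs" if "\<And>x. x \<in> set ?xs \<Longrightarrow> q = g x" for q g
    using that count_list_0_iff[of ?xs] unfolding interpolates_germs_def
    by (metis diff_self dvd_0_right power_0 one_dvd)
  show ?thesis using assms(5)
  proof
    assume "i < j - int p"
    then have "x < u" if x: "x \<in> set ?xs" for x
    proof -
      obtain l where "x = t l" "i \<le> l" "l \<le> i + int p + 1" using x by auto
      then show ?thesis using assms(1,3) \<open>i < j - int p\<close> knot_le[of l] by simp
    qed
    then have "interpolates_germs 0 (germs u p) ?xs"
      by (intro germsI) (simp add: germs_def del: set_map)
    then show ?thesis unfolding has_germ_difference_def by (intro exI[of _ 0]) simp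
  next
    assume "j < i"
    then have "\<not> x < u" if x: "x \<in> set ?xs" for x
    proof -
      obtain l where "x = t l" "i \<le> l" "l \<le> i + int p + 1" using x by auto
      then show ?thesis using assms(2,4) \<open>j < i\<close> knot_ge[of l] by simp
    qed
    then have "interpolates_germs ([:-u, 1:] ^ p) (germs u p) ?xs"
      by (intro germsI) (simp add: germs_def del: set_map)
    moreover have "degree ([:-u, 1:] ^ p) = p" by (simp add: degree_linear_power)
    ultimately show ?thesis unfolding has_germ_difference_def
      by (intro exI[of _ "[:-u, 1:] ^ p"]) (auto simp: coeff_eq_0)
  qed
qed

lemma has_germ_difference_normalized:
  assumes "t j < u" "u < t (j + 1)" "- int m \<le> i" "i + int p + 1 \<le> int n + int m"
  shows "has_germ_difference (germs u p) (map t [i..i + int p + 1]) (normalized p i u)"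
  using assms(3,4)
proof (induction p arbitrary: i)
  case 0
  show ?case
  proof (cases "i = j")
    case True
    \<comment> \<open>The line through 0 at \<open>t j\<close> and 1 at \<open>t (j + 1)\<close>,
      the values of the step function at \<open>u\<close>.\<close>
    have "interpolates_germs (smult (1 / (t (j + 1) - t j)) [:-t j, 1:]) (germs u 0) [t j, t (j + 1)]"
      unfolding interpolates_germs_def
    proof
      fix x
      have "(smult (1 / (t (j + 1) - t j)) [:-t j, 1:]) - 1
        = smult (1 / (t (j + 1) - t j)) [:-t (j + 1), 1:]"
        using span by (simp add: field_simps one_pCons)
      then show "[:-x, 1:] ^ count_list [t j, t (j + 1)] x
          dvd smult (1 / (t (j + 1) - t j)) [:-t j, 1:] - germs u 0 x"
        using assms span by (auto simp: germs_def simp del: smult_pCons intro!: dvd_smult)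
    qed
    moreover have "[j..j + 1] = [j, j + 1]" by (simp add: upto_rec1)
    ultimately show ?thesis using True span
      unfolding has_germ_difference_def normalized_def
      by (intro exI[of _ "smult (1 / (t (j + 1) - t j)) [:-t j, 1:]"]) (auto simp: Bernstein_def)
  next
    case False
    then have "i < j - int 0 \<or> j < i" by auto
    then show ?thesis
      using has_germ_difference_outside[OF assms(1,2) 0] normalized_outside[of i 0 u] by presburger
  qed
next
  case (Suc p)
  show ?case
  proof (cases "i < j - int (Suc p) \<or> j < i")
    case True
    then show ?thesis
      using has_germ_difference_outside[OF assms(1,2) Suc.prems] normalized_outside[of i "Suc p" u]
      by metis
  next
    case False
    let ?ys = "map t [i + 1..i + int p + 1]"
    have lists: "map t [i..i + int p + 1] = t i # ?ys"
      "map t [i + 1..i + 1 + int p + 1] = ?ys @ [t (i + int p + 2)]"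
      "map t [i..i + int (Suc p) + 1] = t i # ?ys @ [t (i + int p + 2)]"
      using upto_rec1[of i "i + int p + 1"] upto_rec1[of i "i + int p + 2"]
        upto_rec2[of "i + 1" "i + int p + 2"]
      by (simp_all add: add_ac)
    have "t i < t (i + int p + 2)"
      using False Suc.prems by (intro less_knots) auto
    then have "t i \<noteq> t (i + int p + 2)" by simp
    moreover have "has_germ_difference (germs u p) (t i # ?ys) (normalized p i u)"
      unfolding lists(1)[symmetric] using Suc.prems by (intro Suc.IH) auto
    moreover have "has_germ_difference (germs u p) (?ys @ [t (i + int p + 2)]) (normalized p (i + 1) u)"
      unfolding lists(2)[symmetric] using Suc.prems by (intro Suc.IH) auto
    ultimately have "has_germ_difference (germs u (Suc p)) (map t [i..i + int (Suc p) + 1])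
        (((u - t i) * normalized p i u + (t (i + int p + 2) - u) * normalized p (i + 1) u)
          / (t (i + int p + 2) - t i))"
      unfolding lists(3) germs_Suc by (rule has_germ_difference_neville)
    moreover have "i + int p + 2 \<le> int n + int m" using Suc.prems by simp
    ultimately show ?thesis using normalized_Suc Suc.prems(1) by simp
  qed
qed

lemma bspline_off_knots_eq:
  assumes "t j < u" "u < t (j + 1)" "- int m \<le> i" "i + int p + 1 \<le> int n + int m"
  shows "bspline_off_knots t p i u = (t (i + int p + 1) - t i) * normalized p i u"
proof -
  let ?xs = "map t [i..i + int p + 1]"
  obtain q where q: "degree q \<le> length ?xs - 1" "interpolates_germs q (germs u p) ?xs"
    "coeff q (length ?xs - 1) = normalized p i u"
    using has_germ_difference_normalized[OF assms] unfolding has_germ_difference_def by blast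
  \<comment> \<open>No knot lies strictly inside the span, so each node has a neighbourhood on one
    side of \<open>u\<close>.\<close>
  have "\<forall>\<^sub>F y in nhds x. truncated_power p y u = poly (germs u p x) y" if "x \<in> set ?xs" for x
  proof -
    obtain l where l: "x = t l" "i \<le> l" "l \<le> i + int p + 1" using \<open>x \<in> set ?xs\<close> by auto
    then have "x \<le> t j \<or> t (j + 1) \<le> x"
      using assms(3,4) knot_le[of l] knot_ge[of l] by (cases "l \<le> j") auto
    then consider "x < u" | "u < x" using assms(1,2) by fastforce
    then show ?thesis
    proof cases
      case 1
      then have "\<forall>\<^sub>F y in nhds x. y < u" by (intro eventually_nhds_in_open[of "{..<u}", simplified])
      then show ?thesis using 1 by (auto elim!: eventually_mono simp: truncated_power_def germs_def)
    next
      case 2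
      then have "\<forall>\<^sub>F y in nhds x. u < y" by (intro eventually_nhds_in_open[of "{u<..}", simplified])
      then show ?thesis using 2
        by (auto elim!: eventually_mono simp: truncated_power_def germs_def poly_power)
    qed
  qed
  then have "divided_difference ?xs (\<lambda>x. truncated_power p x u) = normalized p i u"
    using divided_difference_eqI[of ?xs "\<lambda>x. truncated_power p x u" "germs u p" q] q by simp
  then show ?thesis by (simp add: bspline_off_knots_def)
qed

text \<open>The only knot value in the half-open span is \<open>t j\<close>, where the B-spline is a
  right limit; a polynomial attains its limit.\<close>

lemma bspline_eq:
  assumes "t j \<le> u" "u < t (j + 1)" "p \<le> m" "j - int p \<le> i" "i \<le> j"
  shows "bspline m n t p i u = (t (i + int p + 1) - t i) * normalized p i u"
proof -
  have i: "- int p \<le> i" "i < int n" "- int m \<le> i" "i + int p + 1 \<le> int n + int m"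
    using assms j by auto
  show ?thesis
  proof (cases "u = t j")
    case True
    have "((\<lambda>u. (t (i + int p + 1) - t i) * normalized p i u) \<longlongrightarrow>
        (t (i + int p + 1) - t i) * normalized p i (t j)) (at_right (t j))"
    proof -
      have "isCont (\<lambda>u. (t (i + int p + 1) - t i) * normalized p i u) (t j)"
        unfolding normalized_def Bernstein_def using span by (intro continuous_intros) auto
      then show ?thesis
        unfolding isCont_def filterlim_at_split by (rule conjunct2)
    qed
    moreover have "\<forall>\<^sub>F u in at_right (t j). (t (i + int p + 1) - t i) * normalized p i u
        = bspline_off_knots t p i u"
      using bspline_off_knots_eq i span unfolding eventually_at_right_field by (metis)
    ultimately have "(bspline_off_knots t p i \<longlongrightarrow>
        (t (i + int p + 1) - t i) * normalized p i (t j)) (at_right (t j))"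
      by (rule Lim_transform_eventually)
    then have "Lim (at_right (t j)) (bspline_off_knots t p i)
        = (t (i + int p + 1) - t i) * normalized p i (t j)"
      by (intro tendsto_Lim) auto
    moreover have "t j \<in> t ` knot_ix m n" using j by (auto simp: knot_ix_def)
    ultimately show ?thesis using i True by (simp add: bspline_def)
  next
    case False
    have "u \<noteq> t l" if "l \<in> knot_ix m n" for l
      using knot_le[of l] knot_ge[of l] that assms(1,2) False
      by (cases "l \<le> j") (auto simp: knot_ix_def)
    then have "u \<notin> t ` knot_ix m n" by auto
    then show ?thesis using i bspline_off_knots_eq[of u i p] assms False by (simp add: bspline_def)
  qed
qed

section \<open>Formulas for the adjusted coefficients\<close>

definition bcoef :: "nat \<Rightarrow> int \<Rightarrow> nat \<Rightarrow> real" where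
  "bcoef p i k = (if k \<le> p then (t (i + int p + 1) - t i) * ncoef p i k else 0)"

lemma adjusted_bb_eq:
  assumes "p \<le> m" "j - int p \<le> i" "i \<le> j"
  shows "adjusted_bb m n t p i j = bcoef p i"
  unfolding adjusted_bb_def
proof (rule the_equality)
  let ?x = "\<lambda>u. (u - t j) / (t (j + 1) - t j)"
  have bs: "bspline m n t p i u = (\<Sum>k\<le>p. bcoef p i k * Bernstein p k (?x u))"
    if "t j \<le> u" "u < t (j + 1)" for u
    using bspline_eq[OF that assms]
    by (simp add: normalized_def bcoef_def sum_distrib_left mult_ac)
  then show "(\<forall>u. t j \<le> u \<and> u < t (j + 1) \<longrightarrow> bspline m n t p i u =
      (\<Sum>k\<le>p. bcoef p i k * Bernstein p k (?x u))) \<and> (\<forall>k>p. bcoef p i k = 0)"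
    by (simp add: bcoef_def)
  fix b
  assume b: "(\<forall>u. t j \<le> u \<and> u < t (j + 1) \<longrightarrow> bspline m n t p i u =
      (\<Sum>k\<le>p. b k * Bernstein p k (?x u))) \<and> (\<forall>k>p. b k = 0)"
  show "b = bcoef p i"
  proof
    fix k
    show "b k = bcoef p i k"
    proof (cases "k \<le> p")
      case True
      have "b k - bcoef p i k = 0"
      proof (rule Bernstein_sum_eq_0[where b = "\<lambda>k. b k - bcoef p i k" and p = p and k = k, OF _ True])
        fix x :: real
        assume x: "0 \<le> x" "x < 1"
        define u where "u = t j + x * (t (j + 1) - t j)"
        have less: "x * (t (j + 1) - t j) < 1 * (t (j + 1) - t j)"
          using x span by (intro mult_strict_right_mono) auto
        have "t j \<le> u" "?x u = x" using x span by (auto simp: u_def)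
        moreover have "u < t (j + 1)" using less by (simp only: u_def) simp
        ultimately show "(\<Sum>k\<le>p. (b k - bcoef p i k) * Bernstein p k x) = 0"
          using b bs[of u] by (simp add: left_diff_distrib sum_subtractf)
      qed
      then show ?thesis by simp
    qed (use b in \<open>simp add: bcoef_def\<close>)
  qed
qed

lemma bcoef_outside: "i < j - int p \<or> j < i \<Longrightarrow> bcoef p i k = 0"
  by (simp add: bcoef_def ncoef_outside)

text \<open>The range of \<open>i\<close> exceeds the support by one on either side, to cover the
  neighbours in a recurrence. There both sides are zero, even over a vanishing denominator.\<close>

lemma ncoef_eq_bcoef:
  assumes "p \<le> m" "j - int p - 1 \<le> i" "i \<le> j + 1" "k \<le> p"
  shows "ncoef p i k = bcoef p i k / (t (i + int p + 1) - t i)"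
proof (cases "j - int p \<le> i \<and> i \<le> j")
  case True
  then have "t i < t (i + int p + 1)" using assms j by (intro less_knots) auto
  then show ?thesis using assms(4) by (simp add: bcoef_def)
qed (auto simp: bcoef_outside ncoef_outside)

text \<open>The last coefficient has all blossom arguments equal to \<open>t (j + 1)\<close>, so the
  recurrence stays among last coefficients. It serves step 2 and, for \<open>i = j\<close>, step
  1.\<close>

lemma bcoef_Suc_diag:
  assumes "Suc p \<le> m" "j - int (Suc p) \<le> i" "i \<le> j"
  shows "bcoef (Suc p) i (Suc p) =
    (t (j + 1) - t i) / (t (i + int p + 1) - t i) * bcoef p i p
    + (t (i + int p + 2) - t (j + 1)) / (t (i + int p + 2) - t (i + 1)) * bcoef p (i + 1) p"
proof -
  have "t i < t (i + int p + 2)" using assms j by (intro less_knots) auto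
  then have "bcoef (Suc p) i (Suc p) =
      (t (j + 1) - t i) * ncoef p i p + (t (i + int p + 2) - t (j + 1)) * ncoef p (i + 1) p"
    by (simp add: bcoef_def add_ac)
  then show ?thesis
    using ncoef_eq_bcoef[of p i p] ncoef_eq_bcoef[of p "i + 1" p] assms by (simp add: add_ac)
qed

text \<open>For \<open>k < p\<close> some argument is \<open>t j\<close>. Spending it first gives
  the factor \<open>t j - t j\<close> and the index \<open>j + 1\<close> outside the
  support.\<close>

lemma bcoef_right_eq_0:
  assumes "k < p"
  shows "bcoef p j k = 0"
  using assms by (cases p) (simp_all add: bcoef_def ncoef_outside)

text \<open>The mirror image: for \<open>k > 0\<close> symmetry lets \<open>t (j + 1)\<close> be
  spent first, and again one term has a zero factor and the other lies outside the support.\<close>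

lemma bcoef_left_eq_0:
  assumes "0 < k" "p \<le> m"
  shows "bcoef p (j - int p) k = 0"
proof (cases "k \<le> p")
  case True
  then obtain q l where ql: "p = Suc q" "k = Suc l" "l \<le> q"
    using assms(1) by (metis Suc_le_D Suc_le_mono gr0_conv_Suc)
  have "ncoef (Suc q) (j - int (Suc q)) (Suc l) = 0"
    using ql assms(2) j by (subst ncoef_Suc_Suc) (simp_all add: ncoef_outside add.commute[of 1 j])
  then show ?thesis using ql by (simp only: bcoef_def) simp
qed (simp add: bcoef_def)

text \<open>All arguments are \<open>t j\<close> and one summand survives at each level, so the
  recurrence unrolls to a product. The initial \<open>1 / (t (j + 1) - t j)\<close> cancels one
  power in the numerator, and undoing the normalization cancels the last factor of the
  denominator.\<close>

lemma bcoef_left_0: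
  assumes "Suc q \<le> m"
  shows "bcoef (Suc q) (j - int (Suc q)) 0 =
    (t (j + 1) - t j) ^ q / (\<Prod>k\<leftarrow>[2..<q + 2]. t (j + 1) - t (j - int k + 1))"
  using assms
proof (induction q)
  case 0
  have "t (j - 1) < t (j + 1)" using 0 j by (intro less_knots) auto
  then show ?case using span by (simp add: bcoef_def add.commute[of 1 j])
next
  case (Suc q)
  have less: "t (j - int (Suc (Suc q))) < t (j + 1)" using Suc.prems j by (intro less_knots) auto
  have ix: "j - int (Suc (Suc q)) + 1 = j - int (Suc q)"
    "j - int (Suc (Suc q)) + int (Suc q) + 2 = j + 1" by auto
  have "ncoef (Suc (Suc q)) (j - int (Suc (Suc q))) 0
      = (t (j + 1) - t j) * ncoef (Suc q) (j - int (Suc q)) 0 / (t (j + 1) - t (j - int (Suc (Suc q))))"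
    unfolding ncoef.simps(2)[of "Suc q"] ix
    using ncoef_outside[of "j - int (Suc (Suc q))" "Suc q" 0] by (simp del: ncoef.simps of_nat_Suc)
  then have "bcoef (Suc (Suc q)) (j - int (Suc (Suc q))) 0
      = (t (j + 1) - t j) * ncoef (Suc q) (j - int (Suc q)) 0"
    using less by (simp add: bcoef_def del: ncoef.simps(2))
  also have "ncoef (Suc q) (j - int (Suc q)) 0
      = bcoef (Suc q) (j - int (Suc q)) 0 / (t (j + 1) - t (j - int (Suc q)))"
    using ncoef_eq_bcoef[of "Suc q" "j - int (Suc q)" 0] Suc.prems by (simp del: ncoef.simps(2))
  also have "bcoef (Suc q) (j - int (Suc q)) 0
      = (t (j + 1) - t j) ^ q / (\<Prod>k\<leftarrow>[2..<q + 2]. t (j + 1) - t (j - int k + 1))"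
    using Suc by simp
  finally show ?case by (simp add: algebra_simps)
qed

text \<open>Evaluating one blossom argument at a knot leaves a single term of the recurrence; the two
  lemmas give the same term for consecutive \<open>i\<close>, whence the fourth step.\<close>

lemma ncoef_blossom_left:
  assumes "k \<le> p" "- int m \<le> i" "i \<le> j" "j < i + int p + 2" "i + int p + 2 \<le> int n + int m"
  shows "(t (j + 1) - t i) * ncoef (Suc p) i k - (t j - t i) * ncoef (Suc p) i (Suc k)
    = (t (j + 1) - t j) * ncoef p (i + 1) k"
proof -
  define d where "d = t (i + int p + 2)"
  have d: "d - t i \<noteq> 0" unfolding d_def using less_knots[of i "i + int p + 2"] assms by simp
  define n0 n1 A B where "n0 = ncoef (Suc p) i k" and "n1 = ncoef (Suc p) i (Suc k)"
    and "A = ncoef p i k" and "B = ncoef p (i + 1) k"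
  have n0: "n0 * (d - t i) = (t j - t i) * A + (d - t j) * B"
    using assms(1) d by (simp add: n0_def A_def B_def d_def)
  have n1: "n1 * (d - t i) = (t (j + 1) - t i) * A + (d - t (j + 1)) * B"
    using ncoef_Suc_Suc assms d by (simp add: n1_def A_def B_def d_def del: ncoef.simps(2))
  \<comment> \<open>\<open>n0\<close> and \<open>n1\<close> are values at \<open>t j\<close> and
    \<open>t (j + 1)\<close> of one affine function of the free argument. The combination
    extrapolates it to \<open>t i\<close>, where \<open>A\<close> drops out and \<open>B\<close> has
    weight 1.\<close>
  have "((t (j + 1) - t i) * n0 - (t j - t i) * n1) * (d - t i) = (t (j + 1) - t i) * (n0 * (d - t i)) - (t j - t i) * (n1 * (d - t i))"
    by (simp add: algebra_simps)
  also have "\<dots> = (t (j + 1) - t j) * B * (d - t i)"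
    unfolding n0 n1 by (simp add: algebra_simps)
  finally have "(t (j + 1) - t i) * n0 - (t j - t i) * n1 = (t (j + 1) - t j) * B"
    using d by simp
  then show ?thesis by (simp only: n0_def n1_def A_def B_def d_def)
qed

lemma ncoef_blossom_right:
  assumes "k \<le> p" "- int m \<le> i" "i \<le> j" "j < i + int p + 2" "i + int p + 2 \<le> int n + int m"
  shows "(t (j + 1) - t (i + int p + 2)) * ncoef (Suc p) i k
      + (t (i + int p + 2) - t j) * ncoef (Suc p) i (Suc k)
    = (t (j + 1) - t j) * ncoef p i k"
proof -
  define d where "d = t (i + int p + 2)"
  have d: "d - t i \<noteq> 0" unfolding d_def using less_knots[of i "i + int p + 2"] assms by simp
  define n0 n1 A B where "n0 = ncoef (Suc p) i k" and "n1 = ncoef (Suc p) i (Suc k)"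
    and "A = ncoef p i k" and "B = ncoef p (i + 1) k"
  have n0: "n0 * (d - t i) = (t j - t i) * A + (d - t j) * B"
    using assms(1) d by (simp add: n0_def A_def B_def d_def)
  have n1: "n1 * (d - t i) = (t (j + 1) - t i) * A + (d - t (j + 1)) * B"
    using ncoef_Suc_Suc assms d by (simp add: n1_def A_def B_def d_def del: ncoef.simps(2))
  \<comment> \<open>Here the extrapolation goes to \<open>d\<close>, and \<open>B\<close> drops
    out.\<close>
  have "((t (j + 1) - d) * n0 + (d - t j) * n1) * (d - t i) = (t (j + 1) - d) * (n0 * (d - t i)) + (d - t j) * (n1 * (d - t i))"
    by (simp add: algebra_simps)
  also have "\<dots> = (t (j + 1) - t j) * A * (d - t i)"
    unfolding n0 n1 by (simp add: algebra_simps)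
  finally have "(t (j + 1) - d) * n0 + (d - t j) * n1 = (t (j + 1) - t j) * A"
    using d by simp
  then show ?thesis by (simp only: n0_def n1_def A_def B_def d_def)
qed

lemma bcoef_step4:
  assumes "p \<le> m" "k < p" "j - int p < i" "i < j"
  shows "bcoef p i k = (t j - t i) / (t (j + 1) - t i) * bcoef p i (k + 1)
    + (t (int p + i + 1) - t i) / (t (int p + i + 2) - t (i + 1)) / (t (j + 1) - t i)
      * ((t (j + 1) - t (int p + i + 2)) * bcoef p (i + 1) k
         + (t (int p + i + 2) - t j) * bcoef p (i + 1) (k + 1))"
proof -
  obtain q where q: "p = Suc q" using assms(2) by (cases p) auto
  \<comment> \<open>\<open>E\<close> is the term shared by the blossom identities at
    \<open>i\<close> and \<open>i + 1\<close>; \<open>D\<close> and \<open>D'\<close> undo the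
    normalizations, and \<open>D / D'\<close> is the factor \<open>v\<close> of step 4.\<close>
  define D D' E where "D = t (int p + i + 1) - t i" and "D' = t (int p + i + 2) - t (i + 1)"
    and "E = (t (j + 1) - t j) * ncoef q (i + 1) k"
  have D': "D' \<noteq> 0" unfolding D'_def
    using less_knots[of "i + 1" "int p + i + 2"] assms j by simp
  have ti: "t (j + 1) - t i \<noteq> 0" using less_knots[of i "j + 1"] assms j by simp
  have ix: "i + int q + 2 = int p + i + 1" "i + 1 + int q + 2 = int p + i + 2"
    "i + int p + 1 = int p + i + 1" "i + 1 + int p + 1 = int p + i + 2"
    using q by auto
  have left: "(t (j + 1) - t i) * ncoef p i k - (t j - t i) * ncoef p i (k + 1) = E"
    using ncoef_blossom_left[of k q i] assms j q by (simp add: E_def del: ncoef.simps(2))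
  have right: "(t (j + 1) - t (int p + i + 2)) * ncoef p (i + 1) k
      + (t (int p + i + 2) - t j) * ncoef p (i + 1) (k + 1) = E"
    using ncoef_blossom_right[of k q "i + 1"] assms j q unfolding ix
    by (simp add: E_def del: ncoef.simps(2))
  have b: "bcoef p i l = D * ncoef p i l" "bcoef p (i + 1) l = D' * ncoef p (i + 1) l" if "l \<le> p" for l
    using that by (simp_all only: bcoef_def ix D_def D'_def if_True)
  have "(t (j + 1) - t (int p + i + 2)) * bcoef p (i + 1) k
      + (t (int p + i + 2) - t j) * bcoef p (i + 1) (k + 1) = D' * E"
    using right b(2)[of k] b(2)[of "k + 1"] assms(2)
    by (simp add: right[symmetric] distrib_left mult_ac del: ncoef.simps(2))
  moreover have "bcoef p i k * (t (j + 1) - t i) = (t j - t i) * bcoef p i (k + 1) + D * E"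
    using b(1)[of k] b(1)[of "k + 1"] assms(2)
    by (simp add: left[symmetric] algebra_simps del: ncoef.simps(2))
  then have "bcoef p i k = ((t j - t i) * bcoef p i (k + 1) + D * E) / (t (j + 1) - t i)"
    using ti by (metis nonzero_eq_divide_eq)
  ultimately show ?thesis
    unfolding D_def[symmetric] D'_def[symmetric] using D' by (simp add: add_divide_distrib)
qed

section \<open>Correctness of the four program steps\<close>

definition val :: "cell \<Rightarrow> real" where
  "val = (\<lambda>(p, i, k). adjusted_bb m n t p i j k)"

lemma val_eq: "p \<le> m \<Longrightarrow> j - int p \<le> i \<Longrightarrow> i \<le> j \<Longrightarrow> val (p, i, k) = bcoef p i k"
  by (simp add: val_def adjusted_bb_eq)

lemma computes_step1: "computes t val {} (step1 m j)"
proof -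
  have "computes t val {} [((0, j, 0), Num 1)]"
    using span by (simp add: val_eq bcoef_def)
  moreover have "computes t val {(0, j, 0)} (map (\<lambda>p. ((p, j, p),
      (Knot (j + 1) \<ominus> Knot j) \<oslash> (Knot (j + int p) \<ominus> Knot j) \<otimes> Coef (p - 1) j (p - 1))) [1..<m + 1])"
  proof (rule computes_map[where R = "(<)"])
    fix p s
    assume p: "p \<in> set [1..<m + 1]" and s: "\<forall>c\<in>{(0, j, 0)}. s c = val c"
      "\<forall>q\<in>set [1..<m + 1]. q < p \<longrightarrow> s (fst ((q, j, q), (Knot (j + 1) \<ominus> Knot j) \<oslash>
          (Knot (j + int q) \<ominus> Knot j) \<otimes> Coef (q - 1) j (q - 1)))
        = val (fst ((q, j, q), (Knot (j + 1) \<ominus> Knot j) \<oslash>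
          (Knot (j + int q) \<ominus> Knot j) \<otimes> Coef (q - 1) j (q - 1)))"
    have "1 \<le> p" "p \<le> m" using p by auto
    then obtain q where q: "p = Suc q" "Suc q \<le> m" by (cases p) auto
    have "s (q, j, q) = bcoef q j q"
      using s q by (cases "q = 0") (auto simp: val_eq)
    then show "eval_expr t s (snd ((p, j, p), (Knot (j + 1) \<ominus> Knot j) \<oslash>
          (Knot (j + int p) \<ominus> Knot j) \<otimes> Coef (p - 1) j (p - 1)))
        = val (fst ((p, j, p), (Knot (j + 1) \<ominus> Knot j) \<oslash>
          (Knot (j + int p) \<ominus> Knot j) \<otimes> Coef (p - 1) j (p - 1)))"
      \<comment> \<open>For \<open>i = j\<close> the second summand concerns index
        \<open>j + 1\<close>, outside the support, and drops out.\<close>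
      using q bcoef_Suc_diag[of q j] by (simp add: val_eq bcoef_outside add_ac)
  qed (simp_all del: upt_Suc)
  moreover have "computes t val K (map (\<lambda>k. ((m, j, k), Num 0)) [0..<m])" for K
    by (rule computes_map[where R = "(<)"]) (auto simp: val_eq bcoef_right_eq_0)
  ultimately show ?thesis by (simp add: step1_def computes_append)
qed

lemma cells_step1_eq:
  "fst ` set (step1 m j) =
     insert (0, j, 0) ((\<lambda>p. (p, j, p)) ` {1..<m + 1} \<union> (\<lambda>k. (m, j, k)) ` {0..<m})"
  by (simp add: step1_def image_image image_Un del: upt_Suc)

lemma cells_step1:
  shows "p \<le> m \<Longrightarrow> (p, j, p) \<in> fst ` set (step1 m j)"
    and "k \<le> m \<Longrightarrow> (m, j, k) \<in> fst ` set (step1 m j)"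
  unfolding cells_step1_eq by (cases "p = 0"; cases "k = m"; auto simp: image_iff)+

lemma computes_step2: "computes t val (fst ` set (step1 m j)) (step2 m j)"
  unfolding step2_def
proof (rule computes_concat_map[where R = "(<)"])
  fix p
  assume "p \<in> set [1..<m + 1]"
  then have "1 \<le> p" "p \<le> m" by auto
  then obtain q where q: "p = Suc q" "Suc q \<le> m" by (cases p) auto
  \<comment> \<open>What round \<open>p\<close> reads: level \<open>q = p - 1\<close>, with column
    \<open>j\<close> from step 1 and the others from the previous round. Level 0 has only column
    \<open>j\<close>, hence the guard \<open>1 \<le> q\<close>.\<close>
  define K where "K = fst ` set (step1 m j) \<union> {(q, i, q) | i. 1 \<le> q \<and> i \<in> {j - int q..j - 1}}"
  have diag: "eval_expr t s (diag_coef j q i) = bcoef q i q"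
    if s: "\<forall>c\<in>K. s c = val c" and "i \<le> j" for s i
  proof (cases "i < j - int q")
    case False
    then have "(q, i, q) \<in> K" using that q cells_step1(1)[of q] by (cases "i = j") (auto simp: K_def)
    then show ?thesis using s False q that by (auto simp: diag_coef_def val_eq)
  qed (simp add: diag_coef_def bcoef_outside)
  have "computes t val K (map (\<lambda>i. ((p, i, p),
       (Knot (j + 1) \<ominus> Knot i) \<oslash> (Knot (int p + i) \<ominus> Knot i) \<otimes> diag_coef j (p - 1) i
       \<oplus> (Knot (int p + i + 1) \<ominus> Knot (j + 1)) \<oslash> (Knot (int p + i + 1) \<ominus> Knot (i + 1))
           \<otimes> diag_coef j (p - 1) (i + 1))) (rev [j - int p..j - 1]))"
  proof (rule computes_map[where R = "(>)"], goal_cases)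
    case (3 i s)
    then have i: "j - int (Suc q) \<le> i" "i \<le> j - 1" using q by auto
    have ix: "int (Suc q) + i = i + int q + 1" "int (Suc q) + i + 1 = i + int q + 2" by auto
    show ?case
      using bcoef_Suc_diag[of q i, folded ix] i q(2) diag[OF 3(2), of i] diag[OF 3(2), of "i + 1"]
      unfolding q(1) by (simp add: val_eq del: of_nat_Suc)
  qed (auto simp: sorted_wrt_rev)
  then show "computes t val (fst ` set (step1 m j) \<union>
      (\<Union>y\<in>{y \<in> set [1..<m + 1]. y < p}. fst ` set (map (\<lambda>i. ((y, i, y),
       (Knot (j + 1) \<ominus> Knot i) \<oslash> (Knot (int y + i) \<ominus> Knot i) \<otimes> diag_coef j (y - 1) i
       \<oplus> (Knot (int y + i + 1) \<ominus> Knot (j + 1)) \<oslash> (Knot (int y + i + 1) \<ominus> Knot (i + 1))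
           \<otimes> diag_coef j (y - 1) (i + 1))) (rev [j - int y..j - 1]))))
     (map (\<lambda>i. ((p, i, p),
       (Knot (j + 1) \<ominus> Knot i) \<oslash> (Knot (int p + i) \<ominus> Knot i) \<otimes> diag_coef j (p - 1) i
       \<oplus> (Knot (int p + i + 1) \<ominus> Knot (j + 1)) \<oslash> (Knot (int p + i + 1) \<ominus> Knot (i + 1))
           \<otimes> diag_coef j (p - 1) (i + 1))) (rev [j - int p..j - 1]))"
    by (rule computes_mono) (use q in \<open>auto simp: K_def image_image simp del: upt_Suc intro!: bexI[of _ q]\<close>)
qed (simp_all del: upt_Suc)

lemma cells_step2: "0 < m \<Longrightarrow> j - int m \<le> i \<Longrightarrow> i < j \<Longrightarrow> (m, i, m) \<in> fst ` set (step2 m j)"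
  by (force simp: step2_def)

lemma computes_step3:
  assumes "0 < m"
  shows "computes t val K (step3 m j)"
proof -
  obtain q where q: "m = Suc q" using assms by (cases m) auto
  have "bcoef m (j - int m) 0
      = (t (j + 1) - t j) ^ (m - 1) / (\<Prod>k\<leftarrow>[2..<m + 1]. t (j + 1) - t (j - int k + 1))"
    using bcoef_left_0[of q] q by (simp del: of_nat_Suc upt_Suc)
  then have "eval_expr t s (power_expr (Knot (j + 1) \<ominus> Knot j) (m - 1)
      \<oslash> prod_expr [Knot (j + 1) \<ominus> Knot (j - int k + 1). k \<leftarrow> [2..<m + 1]]) = val (m, j - int m, 0)" for s
    by (simp add: val_eq eval_prod_expr eval_power_expr o_def del: of_nat_Suc upt_Suc)
  moreover have "computes t val K' (map (\<lambda>k. ((m, j - int m, k), Num 0)) [1..<m + 1])" for K'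
    by (rule computes_map[where R = "(<)"]) (auto simp: val_eq bcoef_left_eq_0 simp del: upt_Suc)
  ultimately show ?thesis by (simp add: step3_def computes_append del: upt_Suc)
qed

lemma cells_step3: "k \<le> m \<Longrightarrow> (m, j - int m, k) \<in> fst ` set (step3 m j)"
  by (cases "k = 0") (force simp: step3_def)+

text \<open>The entry at \<open>(i, k)\<close> reads \<open>(i, k + 1)\<close> and
  \<open>(i + 1, k + 1)\<close> from earlier rounds and \<open>(i + 1, k)\<close> from the current
  one. The assumptions provide the border of this grid: column \<open>j\<close> and the row
  \<open>k = m\<close>.\<close>

lemma computes_step4:
  assumes "\<And>k. k \<le> m \<Longrightarrow> (m, j, k) \<in> K" "\<And>i. j - int m \<le> i \<Longrightarrow> i < j \<Longrightarrow> (m, i, m) \<in> K"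
  shows "computes t val K (step4 m j)"
  unfolding step4_def
proof (rule computes_concat_map[where R = "(>)"])
  fix k
  let ?f = "\<lambda>k i. ((m, i, k),
       (Knot j \<ominus> Knot i) \<oslash> (Knot (j + 1) \<ominus> Knot i) \<otimes> Coef m i (k + 1)
       \<oplus> v_expr m i \<oslash> (Knot (j + 1) \<ominus> Knot i)
           \<otimes> ((Knot (j + 1) \<ominus> Knot (int m + i + 2)) \<otimes> Coef m (i + 1) k
              \<oplus> (Knot (int m + i + 2) \<ominus> Knot j) \<otimes> Coef m (i + 1) (k + 1)))"
  let ?is = "rev [j - int m + 1..j - 1]"
  assume "k \<in> set (rev [0..<m])"
  then have k: "k < m" by simp
  show "computes t val (K \<union> (\<Union>k'\<in>{k' \<in> set (rev [0..<m]). k < k'}. fst ` set (map (?f k') ?is)))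
     (map (?f k) ?is)" (is "computes t val ?K _")
  proof (rule computes_map[where R = "(>)"], goal_cases)
    case (3 i s)
    then have i: "j - int m < i" "i < j" by auto
    have known: "s (m, i', k + 1) = bcoef m i' (k + 1)" if "i \<le> i'" "i' \<le> j" for i'
    proof -
      have "(m, i', k + 1) \<in> ?K"
      proof (cases "i' = j \<or> k + 1 = m")
        case True
        then show ?thesis
          using assms(1)[of "k + 1"] assms(2)[of i'] that k i by (cases "i' = j") auto
      next
        case False
        then have "k + 1 \<in> {k' \<in> set (rev [0..<m]). k < k'}" "i' \<in> set ?is" using that k i by auto
        then show ?thesis by (force simp del: set_rev)
      qed
      then show ?thesis using 3(2) that i by (simp add: val_eq)
    qed
    have "s (m, i + 1, k) = bcoef m (i + 1) k"
    proof (cases "i + 1 = j")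
      case True
      then have "(m, i + 1, k) \<in> ?K" using assms(1)[of k] k by auto
      then show ?thesis using 3(2) True k by (simp add: val_eq)
    next
      case False
      then have "i + 1 \<in> set ?is" using i by auto
      then show ?thesis using 3(3) i False by (simp add: val_eq)
    qed
    then show ?case
      using known[of i] known[of "i + 1"] bcoef_step4[of m k i] i k
      by (simp add: val_eq v_expr_def)
  qed (auto simp: sorted_wrt_rev)
qed (auto simp: sorted_wrt_rev)

lemma computes_bb_algorithm:
  assumes "0 < m"
  shows "computes t val {} (bb_algorithm m j)"
proof -
  have "computes t val (fst ` set (step1 m j) \<union> fst ` set (step2 m j) \<union> fst ` set (step3 m j)) (step4 m j)"
    using cells_step1 cells_step2 assms by (intro computes_step4) auto
  then show ?thesis
    using computes_step1 computes_step2 computes_step3[OF assms]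
    by (simp add: bb_algorithm_def computes_append Un_assoc)
qed

text \<open>Column \<open>j\<close> comes from step 1, the row \<open>k = m\<close> from step 2,
  column \<open>j - int m\<close> from step 3 and the interior from step 4.\<close>

lemma cells_bb_algorithm:
  assumes "0 < m" "i \<in> {j - int m..j}" "k \<le> m"
  shows "(m, i, k) \<in> fst ` set (bb_algorithm m j)"
proof -
  have "(m, i, k) \<in> fst ` set (step4 m j)" if "j - int m < i" "i < j" "k < m"
    using that by (force simp: step4_def)
  then consider "(m, i, k) \<in> fst ` set (step1 m j)" | "(m, i, k) \<in> fst ` set (step2 m j)"
    | "(m, i, k) \<in> fst ` set (step3 m j)" | "(m, i, k) \<in> fst ` set (step4 m j)"
    using cells_step1(2)[of k] cells_step2[of i] cells_step3[of k] assms
    by (cases "i = j"; cases "k = m"; cases "i = j - int m") auto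
  then show ?thesis by cases (auto simp: bb_algorithm_def)
qed

end

theorem theorem4p3:
  shows "\<exists>C::nat. \<forall>(m::nat) (n::nat) (t::int \<Rightarrow> real) (j::int).
    m > 0 \<and> n \<ge> 1 \<and>
    mono_on {- int m..int n + int m} t \<and>
    t 0 < t (int n) \<and>
    (\<forall>l\<in>{1..int n - 1}. multiplicity_of_knot m n t (t l) \<le> m) \<and>
    0 \<le> j \<and> j < int n \<and>
    t j < t (j + 1) \<longrightarrow>
      arith_ops (bb_algorithm m j) \<le> C * m ^ 2 \<and>
      (\<forall>s :: cell \<Rightarrow> real.
        (\<forall>((p, i, k), v) \<in> set (run_trace t (bb_algorithm m j) s).
           v = adjusted_bb m n t p i j k) \<and>
        (\<forall>i\<in>{j - int m..j}. \<forall>k\<le>m.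
           exec t (bb_algorithm m j) s (m, i, k) = adjusted_bb m n t m i j k))"
proof (intro exI[of _ 35] allI impI)
  fix m n :: nat and t :: "int \<Rightarrow> real" and j :: int
  assume A: "m > 0 \<and> n \<ge> 1 \<and>
    mono_on {- int m..int n + int m} t \<and>
    t 0 < t (int n) \<and>
    (\<forall>l\<in>{1..int n - 1}. multiplicity_of_knot m n t (t l) \<le> m) \<and>
    0 \<le> j \<and> j < int n \<and>
    t j < t (j + 1)"
  then interpret knot_span m n t j by unfold_locales auto
  have m: "m > 0" using A by simp
  note prog = computes_bb_algorithm[OF m]
  have "v = adjusted_bb m n t p i j k" if "((p, i, k), v) \<in> set (run_trace t (bb_algorithm m j) s)" for p i k v s
    using computes_run_trace[OF prog _ that] by (simp add: val_def)
  moreover have "exec t (bb_algorithm m j) s (m, i, k) = adjusted_bb m n t m i j k"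
    if "i \<in> {j - int m..j}" "k \<le> m" for s i k
    using computes_exec[OF prog, of s "(m, i, k)"] cells_bb_algorithm[OF m that] by (simp add: val_def)
  ultimately show "arith_ops (bb_algorithm m j) \<le> 35 * m\<^sup>2 \<and>
      (\<forall>s :: cell \<Rightarrow> real.
        (\<forall>((p, i, k), v) \<in> set (run_trace t (bb_algorithm m j) s).
           v = adjusted_bb m n t p i j k) \<and>
        (\<forall>i\<in>{j - int m..j}. \<forall>k\<le>m.
           exec t (bb_algorithm m j) s (m, i, k) = adjusted_bb m n t m i j k))"
    using arith_ops_bb_algorithm[OF m] by blast
qed

end
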